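(* Let $k$ be a positive integer and let $G$ be a complete $q$-partite graph ($q\ge 2$) whose parts have orders $n_1 \geq n_2 \geq \cdots \geq n_q$. Then \[ \mathrm{MOF}_k(G) \geq n_1 + \sum_{i=2}^q \max\{n_i-k,0\}. \]
   Context: A complete $q$-partite graph has its vertex set partitioned into $q\ge 2$ independent sets (parts), with every edge between vertices in different parts present. An orientation of $G$ assigns to each edge $\{u,v\}$ exactly one of the arcs $(u,v)$ or $(v,u)$; if $(u,v)$ is an arc, $v$ is an out-neighbor of $u$. Oriented $k$-forcing: given an orientation $D$ and a set $S$ of initially colored vertices, any colored vertex having at most $k$ non-colored out-neighbors forces all of them to become colored; this rule is applied iteratively as long as possible. $S$ is an oriented $k$-forcing set if at the end every vertex is colored. $F_k(D)$ is the minimum size of such a set, and $\mathrm{MOF}_k(G)$ is the maximum of $F_k(D)$ over all orientations $D$ of $G$. *)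

theory Defs
  imports "Graph_Theory.Pair_Digraph" "HOL-Library.Disjoint_Sets"
begin

text \<open>
  Finite simple graphs are finite loop-free symmetric digraphs (\<^locale>\<open>pair_graph\<close>): the edge
  \<open>{u, v}\<close> is represented by the two arcs \<open>(u, v)\<close> and \<open>(v, u)\<close>.
\<close>

definition complete_multipartite :: "'a pair_pre_digraph \<Rightarrow> nat \<Rightarrow> (nat \<Rightarrow> 'a set) \<Rightarrow> bool" where
  "complete_multipartite G q P \<longleftrightarrow>
     pair_graph G \<and> q \<ge> 2 \<and>
     (\<forall>i\<in>{1..q}. P i \<noteq> {}) \<and> disjoint_family_on P {1..q} \<and> (\<Union>i\<in>{1..q}. P i) = pverts G \<and>
     parcs G = {(u, v). \<exists>i\<in>{1..q}. \<exists>j\<in>{1..q}. i \<noteq> j \<and> u \<in> P i \<and> v \<in> P j}"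

definition orientation :: "'a pair_pre_digraph \<Rightarrow> 'a pair_pre_digraph \<Rightarrow> bool" where
  "orientation G D \<longleftrightarrow>
     pverts D = pverts G \<and> parcs D \<subseteq> parcs G \<and>
     (\<forall>u v. (u, v) \<in> parcs G \<longrightarrow> ((u, v) \<in> parcs D) \<noteq> ((v, u) \<in> parcs D))"

definition out_nbrs :: "'a pair_pre_digraph \<Rightarrow> 'a \<Rightarrow> 'a set" where
  "out_nbrs D u = {v. (u, v) \<in> parcs D}"

text \<open>
  \<open>force_step k D C C'\<close>: with \<open>C\<close> the set of colored vertices, a colored vertex that still has
  non-colored out-neighbors, but at most \<open>k\<close> of them, colors them all, giving \<open>C'\<close>. Steps that
  color nothing new are excluded, so ``as long as possible'' means until no step applies.
\<close>

definition force_step :: "nat \<Rightarrow> 'a pair_pre_digraph \<Rightarrow> 'a set \<Rightarrow> 'a set \<Rightarrow> bool" where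
  "force_step k D C C' \<longleftrightarrow>
     (\<exists>u\<in>C. out_nbrs D u - C \<noteq> {} \<and> card (out_nbrs D u - C) \<le> k \<and> C' = C \<union> out_nbrs D u)"

definition final_coloring :: "nat \<Rightarrow> 'a pair_pre_digraph \<Rightarrow> 'a set \<Rightarrow> 'a set \<Rightarrow> bool" where
  "final_coloring k D S C \<longleftrightarrow> (force_step k D)\<^sup>*\<^sup>* S C \<and> (\<nexists>C'. force_step k D C C')"

text \<open>
  The final coloring does not depend on the order in which the forces are performed; see
  \<open>final_coloring_unique\<close> and \<open>final_coloring_exists\<close> below.
\<close>

definition forcing_set :: "nat \<Rightarrow> 'a pair_pre_digraph \<Rightarrow> 'a set \<Rightarrow> bool" where
  "forcing_set k D S \<longleftrightarrow> S \<subseteq> pverts D \<and> final_coloring k D S (pverts D)"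

definition forcing_number :: "nat \<Rightarrow> 'a pair_pre_digraph \<Rightarrow> nat" where
  "forcing_number k D = Min {card S | S. forcing_set k D S}"

definition MOF :: "nat \<Rightarrow> 'a pair_pre_digraph \<Rightarrow> nat" where
  "MOF k G = Max {forcing_number k D | D. orientation G D}"

lemma force_step_verts:
  assumes "pair_fin_digraph D" "(force_step k D)\<^sup>*\<^sup>* S C" "S \<subseteq> pverts D"
  shows "C \<subseteq> pverts D"
  using assms(2,3)
proof (induction rule: rtranclp_induct)
  case (step C C')
  interpret pair_fin_digraph D by fact
  show ?case using step by (auto simp: force_step_def out_nbrs_def dest: in_arcsD2)
qed simp

lemma final_coloring_exists:
  assumes D: "pair_fin_digraph D" and "S \<subseteq> pverts D"
  shows "\<exists>C. final_coloring k D S C"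
  using assms(2)
proof (induction "card (pverts D - S)" arbitrary: S rule: less_induct)
  case less
  interpret pair_fin_digraph D by fact
  show ?case
  proof (cases "\<exists>C'. force_step k D S C'")
    case True
    then obtain C' where C': "force_step k D S C'" by blast
    have sub: "C' \<subseteq> pverts D"
      using force_step_verts[OF D _ less.prems] C' by blast
    have "pverts D - C' \<subset> pverts D - S"
      using C' sub by (auto simp: force_step_def)
    then have "card (pverts D - C') < card (pverts D - S)"
      using pair_finite_verts by (simp add: psubset_card_mono)
    from less.hyps[OF this sub] obtain C where "final_coloring k D C' C" by blast
    with C' have "final_coloring k D S C"
      by (auto simp: final_coloring_def intro: converse_rtranclp_into_rtranclp)
    then show ?thesis by blast
  qed (auto simp: final_coloring_def)
qed

lemma final_coloring_mono:
  assumes D: "pair_fin_digraph D" and "(force_step k D)\<^sup>*\<^sup>* S T" "final_coloring k D S C"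
  shows "T \<subseteq> C"
  using assms(2)
proof (induction rule: rtranclp_induct)
  case base
  have "(force_step k D)\<^sup>*\<^sup>* S C" using assms(3) by (simp add: final_coloring_def)
  then show ?case
    by (induction rule: rtranclp_induct) (auto simp: force_step_def)
next
  case (step T T')
  interpret pair_fin_digraph D by fact
  from step.hyps(2) obtain u where u: "u \<in> T" "card (out_nbrs D u - T) \<le> k"
    "T' = T \<union> out_nbrs D u" by (auto simp: force_step_def)
  have "out_nbrs D u \<subseteq> pverts D" by (auto simp: out_nbrs_def dest: in_arcsD2)
  then have "finite (out_nbrs D u)" using pair_finite_verts finite_subset by blast
  then have "card (out_nbrs D u - C) \<le> card (out_nbrs D u - T)"
    using step.IH by (intro card_mono) auto
  then have "card (out_nbrs D u - C) \<le> k" using u by simp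
  moreover have "\<nexists>C'. force_step k D C C'" using assms(3) by (simp add: final_coloring_def)
  ultimately have "out_nbrs D u \<subseteq> C"
    using u(1) step.IH by (auto simp: force_step_def)
  with step.IH u(3) show ?case by simp
qed

lemma final_coloring_unique:
  assumes "pair_fin_digraph D" "final_coloring k D S C" "final_coloring k D S C'"
  shows "C = C'"
  using final_coloring_mono[OF assms(1) _ assms(2)] final_coloring_mono[OF assms(1) _ assms(3)]
    assms(2,3) by (auto simp: final_coloring_def)

end

theory Submission
  imports Defs
begin

text \<open>
  Orient every edge from the part with the smaller index to the part with the larger one. The
  vertices of the first part have no in-neighbors, so all of them must be colored initially. Two
  vertices of the same part have the same in-neighbors; hence the first force into a part \<open>P i\<close>
  is made by a vertex that has all of \<open>P i\<close> as out-neighbors, at a time when exactly the initially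
  colored vertices of \<open>P i\<close> are colored, and so at most \<open>k\<close> vertices of \<open>P i\<close> are missing from
  the forcing set.
\<close>

text \<open>A step adds only an out-neighborhood, and every out-neighborhood misses
  \<open>A\<close>, so \<open>A \<inter> C\<close> never grows.\<close>

lemma no_in_nbrs_not_forced:
  assumes "\<And>u. out_nbrs D u \<inter> A = {}" and "(force_step k D)\<^sup>*\<^sup>* S C"
  shows "A \<inter> C \<subseteq> S"
  using assms(2)
proof (induction rule: rtranclp_induct)
  case (step C C')
  then obtain u where "C' = C \<union> out_nbrs D u"
    by (auto simp: force_step_def)
  with step.IH assms(1)[of u] show ?case by blast
qed simp

text \<open>The disjunction is an invariant of the process: the first alternative describes
  \<open>A\<close> before any force enters it. The second does not mention \<open>C\<close>, so it
  persists once the first force into \<open>A\<close> has established it.\<close>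

lemma twins_forced_card_le:
  assumes fin: "\<And>u. finite (out_nbrs D u)"
    and twins: "\<And>u. out_nbrs D u \<inter> A = {} \<or> A \<subseteq> out_nbrs D u"
    and "(force_step k D)\<^sup>*\<^sup>* S C"
  shows "A \<inter> C \<subseteq> S \<or> card (A - S) \<le> k"
  using assms(3)
proof (induction rule: rtranclp_induct)
  case (step C C')
  from step.hyps(2) obtain u
    where card: "card (out_nbrs D u - C) \<le> k" and C': "C' = C \<union> out_nbrs D u"
    by (auto simp: force_step_def)
  show ?case
  \<comment> \<open>The true case is a force by \<open>u\<close> onto \<open>A\<close> while only
    vertices of \<open>S\<close> are colored there, so all of \<open>A - S\<close> counts towards
    the bound \<open>k\<close>. Otherwise the second alternative already holds, or \<open>u\<close>
    adds nothing in \<open>A\<close>.\<close>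
  proof (cases "A \<inter> C \<subseteq> S \<and> A \<subseteq> out_nbrs D u")
    case True
    then have "A - S \<subseteq> out_nbrs D u - C" by blast
    then have "card (A - S) \<le> card (out_nbrs D u - C)"
      using fin by (intro card_mono) auto
    with card show ?thesis by simp
  next
    case False
    with step.IH twins[of u] C' show ?thesis by blast
  qed
qed simp

text \<open>\<open>Min\<close> is meaningful only on a finite nonempty set: forcing sets are subsets
  of the finite vertex set, and the whole vertex set is one of them.\<close>

lemma le_forcing_number:
  assumes D: "pair_fin_digraph D" and le: "\<And>S. forcing_set k D S \<Longrightarrow> m \<le> card S"
  shows "m \<le> forcing_number k D"
proof -
  interpret pair_fin_digraph D by fact
  let ?M = "{card S | S. forcing_set k D S}"
  have "?M \<subseteq> card ` Pow (pverts D)"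
    by (auto simp: forcing_set_def)
  then have "finite ?M"
    using pair_finite_verts by (meson finite_Pow_iff finite_imageI finite_subset)
  moreover have "\<nexists>C'. force_step k D (pverts D) C'"
    by (auto simp: force_step_def out_nbrs_def dest: in_arcsD2)
  then have "forcing_set k D (pverts D)"
    by (auto simp: forcing_set_def final_coloring_def)
  then have "?M \<noteq> {}" by blast
  ultimately show ?thesis
    unfolding forcing_number_def using le by (auto simp: Min_ge_iff)
qed

text \<open>Makes the \<open>Max\<close> in \<open>MOF\<close> meaningful. An orientation keeps the
  vertices of \<open>G\<close>, so it is determined by its set of arcs, a subset of
  \<open>parcs G\<close>.\<close>

lemma finite_orientations:
  assumes "pair_fin_digraph G"
  shows "finite {D. orientation G D}"
proof -
  interpret pair_fin_digraph G by fact
  have "{D. orientation G D} \<subseteq> (\<lambda>A. \<lparr>pverts = pverts G, parcs = A\<rparr>) ` Pow (parcs G)"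
    by (auto simp: orientation_def intro!: image_eqI pair_pre_digraph.equality)
  then show ?thesis
    using pair_finite_arcs by (meson finite_Pow_iff finite_imageI finite_subset)
qed

lemma forcing_number_le_MOF:
  assumes "pair_fin_digraph G" and "orientation G D"
  shows "forcing_number k D \<le> MOF k G"
  unfolding MOF_def
  using finite_orientations[OF assms(1)] assms(2) by (auto intro!: Max_ge)

lemma orientation_pair_fin_digraph:
  assumes "pair_fin_digraph G" and "orientation G D"
  shows "pair_fin_digraph D"
proof -
  interpret pair_fin_digraph G by fact
  have D: "pverts D = pverts G" "parcs D \<subseteq> parcs G"
    using assms(2) by (simp_all add: orientation_def)
  show ?thesis
  proof
    show "finite (pverts D)" "finite (parcs D)"
      using D pair_finite_verts pair_finite_arcs by (simp_all add: finite_subset)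
    fix e assume "e \<in> parcs D"
    then have "e \<in> parcs G" using D by blast
    then show "fst e \<in> pverts D" "snd e \<in> pverts D"
      using D wellformed by simp_all
  qed
qed

definition index_orientation :: "'a pair_pre_digraph \<Rightarrow> nat \<Rightarrow> (nat \<Rightarrow> 'a set) \<Rightarrow> 'a pair_pre_digraph"
  where "index_orientation G q P =
    \<lparr>pverts = pverts G,
     parcs = {(u, v). \<exists>i\<in>{1..q}. \<exists>j\<in>{1..q}. i < j \<and> u \<in> P i \<and> v \<in> P j}\<rparr>"

lemma part_index_unique:
  assumes "complete_multipartite G q P" "i \<in> {1..q}" "j \<in> {1..q}" "v \<in> P i" "v \<in> P j"
  shows "i = j"
  using assms unfolding complete_multipartite_def disjoint_family_on_def by blast

lemma orientation_index_orientation: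
  assumes G: "complete_multipartite G q P"
  shows "orientation G (index_orientation G q P)"
proof -
  let ?D = "index_orientation G q P"
  have arcs: "parcs G = {(u, v). \<exists>i\<in>{1..q}. \<exists>j\<in>{1..q}. i \<noteq> j \<and> u \<in> P i \<and> v \<in> P j}"
    using G by (simp add: complete_multipartite_def)
  \<comment> \<open>Disjointness of the parts makes the indices of the endpoints unique, so exactly
    one direction being an arc reduces to comparing two distinct numbers.\<close>
  have iff: "(u, v) \<in> parcs ?D \<longleftrightarrow> i < j"
    if ij: "i \<in> {1..q}" "j \<in> {1..q}" "u \<in> P i" "v \<in> P j" for u v i j
  proof
    assume "(u, v) \<in> parcs ?D"
    then obtain i' j' where "i' \<in> {1..q}" "j' \<in> {1..q}" "i' < j'" "u \<in> P i'" "v \<in> P j'"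
      by (auto simp: index_orientation_def)
    then show "i < j"
      using part_index_unique[OF G ij(1) _ ij(3), of i'] part_index_unique[OF G ij(2) _ ij(4), of j']
      by simp
  next
    assume "i < j"
    with ij show "(u, v) \<in> parcs ?D"
      unfolding index_orientation_def by fastforce
  qed
  have "((u, v) \<in> parcs ?D) \<noteq> ((v, u) \<in> parcs ?D)" if "(u, v) \<in> parcs G" for u v
  proof -
    from that obtain i j where ij: "i \<in> {1..q}" "j \<in> {1..q}" "i \<noteq> j" "u \<in> P i" "v \<in> P j"
      unfolding arcs by blast
    show ?thesis
      using iff[OF ij(1,2,4,5)] iff[OF ij(2,1,5,4)] ij(3) by auto
  qed
  moreover have "parcs ?D \<subseteq> parcs G"
    unfolding arcs index_orientation_def using less_imp_neq by auto
  ultimately show ?thesis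
    by (simp add: orientation_def index_orientation_def)
qed

text \<open>The condition on \<open>u\<close> does not depend on the vertex chosen in
  \<open>P i\<close>. This all-or-nothing form supplies the twin hypothesis of
  \<open>twins_forced_card_le\<close>.\<close>

lemma index_orientation_out_nbrs_Int_part:
  assumes G: "complete_multipartite G q P" and i: "i \<in> {1..q}"
  shows "out_nbrs (index_orientation G q P) u \<inter> P i =
    (if \<exists>j\<in>{1..<i}. u \<in> P j then P i else {})"
proof -
  have "v \<in> out_nbrs (index_orientation G q P) u \<longleftrightarrow> (\<exists>j\<in>{1..<i}. u \<in> P j)" if "v \<in> P i" for v
  proof
    assume "v \<in> out_nbrs (index_orientation G q P) u"
    then obtain j i' where "j \<in> {1..q}" "i' \<in> {1..q}" "j < i'" "u \<in> P j" "v \<in> P i'"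
      by (auto simp: out_nbrs_def index_orientation_def)
    moreover from this have "i' = i" using part_index_unique[OF G _ i _ that] by blast
    ultimately show "\<exists>j\<in>{1..<i}. u \<in> P j" by auto
  next
    assume "\<exists>j\<in>{1..<i}. u \<in> P j"
    then obtain j where "j \<in> {1..q}" "j < i" "u \<in> P j"
      using i by (metis atLeastAtMost_iff atLeastLessThan_iff less_imp_le le_trans)
    then show "v \<in> out_nbrs (index_orientation G q P) u"
      using i that unfolding out_nbrs_def index_orientation_def by fastforce
  qed
  then show ?thesis by auto
qed

lemma index_orientation_forcing_set_card:
  assumes G: "complete_multipartite G q P" and "q \<ge> 2"
    and S: "forcing_set k (index_orientation G q P) S"
  shows "card (P 1) + (\<Sum>i=2..q. card (P i) - k) \<le> card S"
proof -
  let ?D = "index_orientation G q P"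
  have "pair_graph G" and verts: "(\<Union>i\<in>{1..q}. P i) = pverts G"
    and disj: "disjoint_family_on P {1..q}"
    using G by (simp_all add: complete_multipartite_def)
  interpret pair_graph G by fact
  interpret D: pair_fin_digraph ?D
    by (rule orientation_pair_fin_digraph[OF _ orientation_index_orientation[OF G]]) unfold_locales
  have finP: "finite (P i)" if "i \<in> {1..q}" for i
    using that verts pair_finite_verts by (metis UN_upper finite_subset)
  have SV: "S \<subseteq> pverts G" and forced: "(force_step k ?D)\<^sup>*\<^sup>* S (pverts G)"
    using S by (auto simp: forcing_set_def final_coloring_def index_orientation_def)
  have fin_out: "finite (out_nbrs ?D u)" for u
    by (rule finite_subset[OF _ D.pair_finite_verts]) (auto simp: out_nbrs_def dest: D.in_arcsD2)
  have first: "P 1 \<subseteq> S"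
  proof -
    have "1 \<in> {1..q}" using \<open>q \<ge> 2\<close> by simp
    \<comment> \<open>The range \<open>{1..<1}\<close> of possible in-neighbor parts is
      empty.\<close>
    moreover have "out_nbrs ?D u \<inter> P 1 = {}" for u
      using index_orientation_out_nbrs_Int_part[OF G \<open>1 \<in> {1..q}\<close>, of u] by simp
    ultimately show ?thesis
      using no_in_nbrs_not_forced[OF _ forced, of "P 1"] verts by blast
  qed
  have rest: "card (P i) - k \<le> card (P i \<inter> S)" if i: "i \<in> {1..q}" for i
  proof -
    have "P i \<inter> pverts G \<subseteq> S \<or> card (P i - S) \<le> k"
      using index_orientation_out_nbrs_Int_part[OF G i]
      by (intro twins_forced_card_le[OF fin_out _ forced]) (metis inf.cobounded1)
    moreover have "P i \<subseteq> pverts G" using i verts by blast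
    \<comment> \<open>In the first alternative \<open>P i - S\<close> is empty, since the final
      coloring is all of \<open>pverts G\<close>.\<close>
    ultimately have "card (P i - S) \<le> k"
      by (metis Diff_eq_empty_iff card.empty inf.absorb1 le0)
    moreover have "card (P i) = card (P i \<inter> S) + card (P i - S)"
      using finP[OF i] by (metis card_Int_Diff)
    ultimately show ?thesis by simp
  qed
  have split: "{1..q} = insert 1 {2..q}" using \<open>q \<ge> 2\<close> by auto
  have "card (P 1) + (\<Sum>i=2..q. card (P i) - k) \<le> card (P 1 \<inter> S) + (\<Sum>i=2..q. card (P i \<inter> S))"
    using first rest by (intro add_mono sum_mono) (auto simp: Int_absorb2)
  also have "\<dots> = (\<Sum>i\<in>{1..q}. card (P i \<inter> S))"
    unfolding split by simp
  also have "\<dots> = card (\<Union>i\<in>{1..q}. P i \<inter> S)"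
    using finP disj by (intro card_UN_disjoint[symmetric]) (auto simp: disjoint_family_on_def)
  also have "(\<Union>i\<in>{1..q}. P i \<inter> S) = S"
    using SV verts by blast
  finally show ?thesis .
qed

theorem theorem12:
  fixes G :: "'a pair_pre_digraph" and P :: "nat \<Rightarrow> 'a set" and n :: "nat \<Rightarrow> nat" and q k :: nat
  assumes "k > 0"
    and "q \<ge> 2"
    and "complete_multipartite G q P"
    and "\<And>i. i \<in> {1..q} \<Longrightarrow> card (P i) = n i"
    and "\<And>i j. 1 \<le> i \<Longrightarrow> i \<le> j \<Longrightarrow> j \<le> q \<Longrightarrow> n j \<le> n i"
  shows "int (MOF k G) \<ge> int (n 1) + (\<Sum>i=2..q. max (int (n i) - int k) 0)"
proof -
  let ?D = "index_orientation G q P"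
  have "pair_graph G" using assms(3) by (simp add: complete_multipartite_def)
  then interpret pair_graph G .
  have G: "pair_fin_digraph G" by unfold_locales
  note D = orientation_index_orientation[OF assms(3)]
  have "card (P 1) + (\<Sum>i=2..q. card (P i) - k) \<le> forcing_number k ?D"
    by (rule le_forcing_number[OF orientation_pair_fin_digraph[OF G D]
        index_orientation_forcing_set_card[OF assms(3,2)]])
  also have "\<dots> \<le> MOF k G"
    by (rule forcing_number_le_MOF[OF G D])
  finally have "int (card (P 1) + (\<Sum>i=2..q. card (P i) - k)) \<le> int (MOF k G)"
    by (simp only: of_nat_le_iff)
  \<comment> \<open>Truncated subtraction on naturals is exactly the maximum with 0 on
    integers.\<close>
  moreover have "int (\<Sum>i=2..q. card (P i) - k) = (\<Sum>i=2..q. max (int (n i) - int k) 0)"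
    unfolding of_nat_sum by (rule sum.cong) (simp_all add: assms(4) max_def)
  ultimately show ?thesis
    using assms(2,4) by simp
qed

end
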